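(* Let $n$ be a positive integer and let $H$ be an Abelian group. Assume that $\gamma:[n]\times[n]\to H$ is simple cycle free. Then the graph $\mathcal{B}_n$ contains an independent set of size at least $n!/|H|$.
   Context: $[n]=\{1,\ldots,n\}$. The complete bipartite graph $K_{n,n}$ has two disjoint vertex classes, each a copy of $[n]$, and its edges are identified with the pairs $(x,y)\in[n]\times[n]$ ($x$ in the first class, $y$ in the second). For an Abelian group $H$ (written additively), a labeling $\gamma:[n]\times[n]\to H$ is called simple cycle free if for every simple cycle $C$ in $K_{n,n}$ (a closed walk with no repeated vertices, of length $2k$ with $k\ge 2$) one has $\sum_{e\in C}\mathrm{sign}(e)\gamma(e)\neq 0$ in $H$, where $\mathrm{sign}(e)\in\{-1,1\}$ is an alternating sign assignment to the edges of $C$ (consecutive edges along $C$ receive opposite signs; the two possible choices differ by a global sign, so the condition does not depend on the choice). If $H$ is infinite, $n!/|H|$ is read as $0$. $S_n$ is the symmetric group on $[n]$. A permutation $\tau\in S_n$ is called a cycle if, except for its fixed points, it consists of a single non-trivial cycle (of any length between $2$ and $n$; in particular the identity is not a cycle). Let $\mathcal{C}_n\subset S_n$ be the set of cycles. The (Birkhoff polytope) graph $\mathcal{B}_n=\mathrm{Cay}(S_n,\mathcal{C}_n)$ is the undirected graph with vertex set $S_n$ and edges $\{\pi,\tau\pi\}$ for $\pi\in S_n$, $\tau\in\mathcal{C}_n$. An independent set is a set $A\subset S_n$ containing no two adjacent vertices, i.e. there are no $\pi,\pi'\in A$ with $\pi(\pi')^{-1}\in\mathcal{C}_n$. *)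

theory Defs
  imports Complex_Main "HOL-Combinatorics.Combinatorics"
begin

text \<open>
  The complete bipartite graph $K_{n,n}$: the first vertex class consists of the \<open>Inl x\<close>, the
  second of the \<open>Inr y\<close>, with \<open>x, y \<in> {1..n}\<close>.
\<close>

definition knn_verts :: "nat \<Rightarrow> (nat + nat) set" where
  "knn_verts n = {1..n} <+> {1..n}"

definition knn_adj :: "nat \<Rightarrow> nat + nat \<Rightarrow> nat + nat \<Rightarrow> bool" where
  "knn_adj n u v \<longleftrightarrow> u \<in> knn_verts n \<and> v \<in> knn_verts n \<and> isl u \<noteq> isl v"

text \<open>
  The pair identified with the edge between \<open>u\<close> and \<open>v\<close>, in whichever direction the edge is
  traversed; meaningful only if \<open>u\<close> and \<open>v\<close> lie in different classes.
\<close>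

definition knn_edge :: "nat + nat \<Rightarrow> nat + nat \<Rightarrow> nat \<times> nat" where
  "knn_edge u v = (if isl u then (projl u, projr v) else (projl v, projr u))"

text \<open>
  A simple cycle is given by the list of its vertices; the closing edge joins the last vertex to
  the first.
\<close>

definition simple_cycle :: "nat \<Rightarrow> (nat + nat) list \<Rightarrow> bool" where
  "simple_cycle n vs \<longleftrightarrow>
     (\<exists>k\<ge>2. length vs = 2 * k) \<and> distinct vs \<and>
     (\<forall>i<length vs. knn_adj n (vs ! i) (vs ! (Suc i mod length vs)))"

definition alternating_sum :: "(nat \<times> nat \<Rightarrow> 'h::ab_group_add) \<Rightarrow> (nat + nat) list \<Rightarrow> 'h" where
  "alternating_sum \<gamma> vs =
     (\<Sum>i<length vs.
        let e = knn_edge (vs ! i) (vs ! (Suc i mod length vs))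
        in if even i then \<gamma> e else - \<gamma> e)"

text \<open>Only the values of \<open>\<gamma>\<close> on \<open>{1..n} \<times> {1..n}\<close> matter.\<close>

definition simple_cycle_free :: "nat \<Rightarrow> (nat \<times> nat \<Rightarrow> 'h::ab_group_add) \<Rightarrow> bool" where
  "simple_cycle_free n \<gamma> \<longleftrightarrow> (\<forall>vs. simple_cycle n vs \<longrightarrow> alternating_sum \<gamma> vs \<noteq> 0)"

definition sym_perms :: "nat \<Rightarrow> (nat \<Rightarrow> nat) set" where
  "sym_perms n = {\<pi>. \<pi> permutes {1..n}}"

definition cycle_perms :: "nat \<Rightarrow> (nat \<Rightarrow> nat) set" where
  "cycle_perms n =
     {cycle_of_list cs |cs. distinct cs \<and> 2 \<le> length cs \<and> set cs \<subseteq> {1..n}}"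

definition birkhoff_edges :: "nat \<Rightarrow> (nat \<Rightarrow> nat) set set" where
  "birkhoff_edges n = {{\<pi>, \<tau> \<circ> \<pi>} |\<pi> \<tau>. \<pi> \<in> sym_perms n \<and> \<tau> \<in> cycle_perms n}"

definition birkhoff_independent :: "nat \<Rightarrow> (nat \<Rightarrow> nat) set \<Rightarrow> bool" where
  "birkhoff_independent n A \<longleftrightarrow>
     A \<subseteq> sym_perms n \<and> (\<forall>\<pi>\<in>A. \<forall>\<pi>'\<in>A. {\<pi>, \<pi>'} \<notin> birkhoff_edges n)"

end

theory Submission
  imports Defs
begin

text \<open>
  Give a permutation \<open>\<pi>\<close> the weight \<open>\<Sum>x. \<gamma> (x, \<pi> x)\<close>. If \<open>\<tau>\<close> is a cycle, then the perfect
  matchings of \<open>\<pi>\<close> and \<open>\<tau> \<circ> \<pi>\<close> differ in the edges of a single simple cycle, on which they alternate;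
  hence the weights differ by an alternating sum, which does not vanish. So every set of permutations
  of equal weight is independent, and by pigeonhole one of these sets has at least \<open>n!/|H|\<close> elements.
\<close>

definition perm_weight :: "nat \<Rightarrow> (nat \<times> nat \<Rightarrow> 'h::ab_group_add) \<Rightarrow> (nat \<Rightarrow> nat) \<Rightarrow> 'h" where
  "perm_weight n \<gamma> \<pi> = (\<Sum>x\<in>{1..n}. \<gamma> (x, \<pi> x))"

text \<open>With \<open>c_j = cs ! j\<close>, the vertices run \<open>c_0\<close>,
  \<open>inv \<pi> c_0\<close>, \<open>c_1\<close>, \<open>inv \<pi> c_1\<close>, and so on. Edge
  \<open>2 * j\<close> is then the edge of the matching of \<pi> at \<open>inv \<pi> c_j\<close>,
  and edge \<open>2 * j + 1\<close> the one of \<open>cycle_of_list cs \<circ> \<pi>\<close>.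
  Starting on the \<open>Inr\<close> side gives the edges of \<pi> the positive sign.\<close>

definition matching_cycle :: "(nat \<Rightarrow> nat) \<Rightarrow> nat list \<Rightarrow> (nat + nat) list" where
  "matching_cycle \<pi> cs =
     map (\<lambda>i. if even i then Inr (cs ! (i div 2)) else Inl (inv \<pi> (cs ! (i div 2))))
       [0..<2 * length cs]"

lemma cycle_of_list_nth:
  assumes "distinct cs" "i < length cs"
  shows "cycle_of_list cs (cs ! i) = cs ! (Suc i mod length cs)"
proof -
  have "map (cycle_of_list cs) cs ! i = rotate1 cs ! i"
    using cyclic_rotation[OF assms(1), of 1] by simp
  then show ?thesis
    using assms(2) by (simp add: nth_rotate1)
qed

text \<open>Groups an alternating sum into pairs of consecutive edges; in
  \<open>matching_cycle\<close> the two edges of a pair share the vertex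
  \<open>Inl (inv \<pi> (cs ! j))\<close>.\<close>

lemma sum_lessThan_double:
  fixes g :: "nat \<Rightarrow> 'a::comm_monoid_add"
  shows "sum g {..<2 * k} = (\<Sum>j<k. g (2 * j) + g (Suc (2 * j)))"
  by (induction k) (simp_all add: add.assoc)

lemma Suc_double_mod:
  "Suc (2 * j) mod (2 * k) = Suc (2 * j)" if "j < k" for j k :: nat
  using that by simp

text \<open>The factor 2 comes out of the modulus, so the closing edge of the cycle needs no
  separate case.\<close>

lemma Suc_Suc_double_mod:
  "Suc (Suc (2 * j)) mod (2 * k) = 2 * (Suc j mod k)" for j k :: nat
  using mult_mod_right[of 2 "Suc j" k] by simp

lemma length_matching_cycle [simp]: "length (matching_cycle \<pi> cs) = 2 * length cs"
  by (simp add: matching_cycle_def)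

lemma matching_cycle_nth:
  assumes "j < length cs"
  shows "matching_cycle \<pi> cs ! (2 * j) = Inr (cs ! j)"
    and "matching_cycle \<pi> cs ! Suc (2 * j) = Inl (inv \<pi> (cs ! j))"
  using assms by (simp_all add: matching_cycle_def)

lemma matching_cycle_nth_next:
  assumes "j < length cs"
  shows "matching_cycle \<pi> cs ! (Suc (2 * j) mod (2 * length cs)) = Inl (inv \<pi> (cs ! j))"
    and "matching_cycle \<pi> cs ! (Suc (Suc (2 * j)) mod (2 * length cs)) =
           Inr (cs ! (Suc j mod length cs))"
proof -
  show "matching_cycle \<pi> cs ! (Suc (2 * j) mod (2 * length cs)) = Inl (inv \<pi> (cs ! j))"
    unfolding Suc_double_mod[OF assms] by (rule matching_cycle_nth(2)[OF assms])
  have "Suc j mod length cs < length cs"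
    using assms by (intro mod_less_divisor) linarith
  then show "matching_cycle \<pi> cs ! (Suc (Suc (2 * j)) mod (2 * length cs)) =
           Inr (cs ! (Suc j mod length cs))"
    unfolding Suc_Suc_double_mod by (rule matching_cycle_nth(1))
qed

text \<open>The class of a vertex reveals the parity of its position. Within a class, distinctness
  of \<open>cs\<close> and injectivity of \<open>inv \<pi>\<close> reveal half the position, rounded
  down. The two together determine the position, so no vertex repeats.\<close>

lemma simple_cycle_matching_cycle:
  assumes \<pi>: "\<pi> permutes {1..n}"
    and cs: "distinct cs" "2 \<le> length cs" "set cs \<subseteq> {1..n}"
  shows "simple_cycle n (matching_cycle \<pi> cs)"
proof -
  have inj: "inj (inv \<pi>)"
    by (rule permutes_inj[OF permutes_inv[OF \<pi>]])
  have Inr_vert: "Inr (cs ! j) \<in> knn_verts n" if "j < length cs" for j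
    using cs(3) nth_mem[OF that] by (auto simp: knn_verts_def)
  have Inl_vert: "Inl (inv \<pi> (cs ! j)) \<in> knn_verts n" if "j < length cs" for j
    using cs(3) nth_mem[OF that] permutes_in_image[OF permutes_inv[OF \<pi>]]
    by (auto simp: knn_verts_def)
  have "distinct (matching_cycle \<pi> cs)"
    unfolding matching_cycle_def distinct_map
  proof (intro conjI inj_onI)
    fix i j
    assume ij: "i \<in> set [0..<2 * length cs]" "j \<in> set [0..<2 * length cs]"
      and eq: "(if even i then Inr (cs ! (i div 2)) else Inl (inv \<pi> (cs ! (i div 2)))) =
               (if even j then Inr (cs ! (j div 2)) else Inl (inv \<pi> (cs ! (j div 2))))"
    have par: "even i \<longleftrightarrow> even j"
      using eq by (auto split: if_splits)
    moreover have "cs ! (i div 2) = cs ! (j div 2)"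
      using eq par injD[OF inj] by (auto split: if_splits)
    then have "i div 2 = j div 2"
      using ij cs(1) by (simp add: nth_eq_iff_index_eq less_mult_imp_div_less mult.commute)
    ultimately show "i = j"
      by (metis bit_eq_rec)
  qed simp
  moreover have "knn_adj n (matching_cycle \<pi> cs ! i)
      (matching_cycle \<pi> cs ! (Suc i mod (2 * length cs)))" if "i < 2 * length cs" for i
  proof -
    define j where "j = i div 2"
    have j: "j < length cs"
      using that by (simp add: j_def less_mult_imp_div_less mult.commute)
    then have j': "Suc j mod length cs < length cs"
      by (intro mod_less_divisor) linarith
    consider "i = 2 * j" | "i = Suc (2 * j)"
      unfolding j_def by (cases "even i") (auto elim: oddE)
    then show ?thesis
      using Inr_vert[OF j] Inr_vert[OF j'] Inl_vert[OF j]
      by cases (simp_all only: matching_cycle_nth[OF j] matching_cycle_nth_next[OF j]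
        knn_adj_def sum.disc simp_thms)
  qed
  ultimately show ?thesis
    using cs(2) unfolding simple_cycle_def by auto
qed

text \<open>Both matchings agree at every \<open>x\<close> with \<open>\<pi> x\<close> outside
  \<open>cs\<close>, since the cycle fixes \<open>\<pi> x\<close>. What survives of the difference
  of weights is one pair of edges for each entry of \<open>cs\<close>, and these pairs make up the
  alternating sum.\<close>

lemma alternating_sum_matching_cycle:
  fixes \<gamma> :: "nat \<times> nat \<Rightarrow> 'h::ab_group_add"
  assumes \<pi>: "\<pi> permutes {1..n}"
    and cs: "distinct cs" "set cs \<subseteq> {1..n}"
  shows "alternating_sum \<gamma> (matching_cycle \<pi> cs) =
           perm_weight n \<gamma> \<pi> - perm_weight n \<gamma> (cycle_of_list cs \<circ> \<pi>)"
proof -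
  let ?\<tau> = "cycle_of_list cs"
  let ?d = "\<lambda>x. \<gamma> (x, \<pi> x) - \<gamma> (x, ?\<tau> (\<pi> x))"
  have \<pi>_inv: "\<pi> (inv \<pi> c) = c" for c
    by (rule permutes_inverses(1)[OF \<pi>])
  have inv_\<pi>: "inv \<pi> (\<pi> x) = x" for x
    by (rule permutes_inverses(2)[OF \<pi>])
  have inj: "inj_on (inv \<pi>) (set cs)"
    by (metis \<pi>_inv inj_onI)
  have sub: "inv \<pi> ` set cs \<subseteq> {1..n}"
    using cs(2) permutes_in_image[OF permutes_inv[OF \<pi>]] by blast
  have outside: "?d x = 0" if "x \<in> {1..n} - inv \<pi> ` set cs" for x
  proof -
    have "\<pi> x \<notin> set cs"
      using that inv_\<pi> by (metis DiffD2 imageI)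
    then show ?thesis
      by (simp add: id_outside_supp)
  qed
  have "perm_weight n \<gamma> \<pi> - perm_weight n \<gamma> (?\<tau> \<circ> \<pi>) = sum ?d {1..n}"
    by (simp add: perm_weight_def sum_subtractf)
  also have "\<dots> = sum ?d (inv \<pi> ` set cs)"
    by (rule sum.mono_neutral_right[OF _ sub]) (use outside in auto)
  also have "\<dots> = (\<Sum>c\<in>set cs. \<gamma> (inv \<pi> c, c) - \<gamma> (inv \<pi> c, ?\<tau> c))"
    by (simp add: sum.reindex[OF inj] \<pi>_inv)
  also have "\<dots> = (\<Sum>j<length cs. \<gamma> (inv \<pi> (cs ! j), cs ! j) - \<gamma> (inv \<pi> (cs ! j), ?\<tau> (cs ! j)))"
    by (rule sum.reindex_bij_betw[OF bij_betw_nth[OF cs(1) refl refl], symmetric])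
  also have "\<dots> = alternating_sum \<gamma> (matching_cycle \<pi> cs)"
    unfolding alternating_sum_def length_matching_cycle sum_lessThan_double
  proof (rule sum.cong[OF refl])
    fix j assume "j \<in> {..<length cs}"
    then have j: "j < length cs" by simp
    show "\<gamma> (inv \<pi> (cs ! j), cs ! j) - \<gamma> (inv \<pi> (cs ! j), ?\<tau> (cs ! j)) =
      (let e = knn_edge (matching_cycle \<pi> cs ! (2 * j))
                 (matching_cycle \<pi> cs ! (Suc (2 * j) mod (2 * length cs)))
       in if even (2 * j) then \<gamma> e else - \<gamma> e) +
      (let e = knn_edge (matching_cycle \<pi> cs ! Suc (2 * j))
                 (matching_cycle \<pi> cs ! (Suc (Suc (2 * j)) mod (2 * length cs)))
       in if even (Suc (2 * j)) then \<gamma> e else - \<gamma> e)"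
      unfolding matching_cycle_nth[OF j] matching_cycle_nth_next[OF j]
      by (simp add: knn_edge_def cycle_of_list_nth[OF cs(1) j])
  qed
  finally show ?thesis ..
qed

lemma perm_weight_cycle_neq:
  assumes "simple_cycle_free n \<gamma>" "\<pi> \<in> sym_perms n" "\<tau> \<in> cycle_perms n"
  shows "perm_weight n \<gamma> (\<tau> \<circ> \<pi>) \<noteq> perm_weight n \<gamma> \<pi>"
proof -
  obtain cs where cs: "\<tau> = cycle_of_list cs" "distinct cs" "2 \<le> length cs" "set cs \<subseteq> {1..n}"
    using assms(3) by (auto simp: cycle_perms_def)
  have \<pi>: "\<pi> permutes {1..n}"
    using assms(2) by (simp add: sym_perms_def)
  have "alternating_sum \<gamma> (matching_cycle \<pi> cs) \<noteq> 0"
    using assms(1) simple_cycle_matching_cycle[OF \<pi> cs(2-4)] by (simp add: simple_cycle_free_def)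
  then show ?thesis
    by (simp add: alternating_sum_matching_cycle[OF \<pi> cs(2,4)] cs(1))
qed

lemma birkhoff_independent_fibre:
  assumes "simple_cycle_free n \<gamma>"
  shows "birkhoff_independent n {\<pi> \<in> sym_perms n. perm_weight n \<gamma> \<pi> = h}"
  unfolding birkhoff_independent_def
proof (intro conjI ballI notI)
  fix \<pi> \<pi>'
  assume \<pi>: "\<pi> \<in> {\<pi> \<in> sym_perms n. perm_weight n \<gamma> \<pi> = h}"
    and \<pi>': "\<pi>' \<in> {\<pi> \<in> sym_perms n. perm_weight n \<gamma> \<pi> = h}"
    and "{\<pi>, \<pi>'} \<in> birkhoff_edges n"
  then obtain \<rho> \<tau> where \<rho>: "{\<pi>, \<pi>'} = {\<rho>, \<tau> \<circ> \<rho>}" "\<rho> \<in> sym_perms n" "\<tau> \<in> cycle_perms n"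
    unfolding birkhoff_edges_def by blast
  \<comment> \<open>The edge is an unordered pair, so either of \<pi> and \<pi>' may be \<rho>. No
    case split is needed, as both have weight \<open>h\<close>.\<close>
  have "\<rho> \<in> {\<pi>, \<pi>'}" "\<tau> \<circ> \<rho> \<in> {\<pi>, \<pi>'}"
    unfolding \<rho>(1) by simp_all
  then have "perm_weight n \<gamma> (\<tau> \<circ> \<rho>) = perm_weight n \<gamma> \<rho>"
    using \<pi> \<pi>' by auto
  then show False
    using perm_weight_cycle_neq[OF assms \<rho>(2,3)] by contradiction
qed auto

lemma exists_large_fibre:
  fixes f :: "'a \<Rightarrow> 'b"
  assumes "finite S" "finite (UNIV :: 'b set)"
  shows "\<exists>y. real (card S) / real (card (UNIV :: 'b set)) \<le> real (card {x \<in> S. f x = y})"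
proof (rule ccontr)
  assume "\<not> ?thesis"
  then have "real (card {x \<in> S. f x = y}) < real (card S) / real (card (UNIV :: 'b set))" for y
    by (simp add: not_le)
  \<comment> \<open>Values not attained count as empty fibres, so the average is over the whole
    type. The sum of the strict bounds stays strict because a type is nonempty.\<close>
  then have "(\<Sum>y\<in>UNIV. real (card {x \<in> S. f x = y})) <
      of_nat (card (UNIV :: 'b set)) * (real (card S) / real (card (UNIV :: 'b set)))"
    using assms(2) by (intro sum_bounded_above_strict) (simp_all add: finite_UNIV_card_ge_0)
  moreover have "(\<Sum>y\<in>UNIV. real (card {x \<in> S. f x = y})) = real (card S)"
    using sum.group[OF assms, of f "\<lambda>_. 1::real"] by simp
  ultimately show False
    using finite_UNIV_card_ge_0[OF assms(2)] by simp
qed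

(* For an infinite group, card UNIV = 0 and division by 0 yields 0, so that n!/|H| is read as 0. *)
theorem claim1p5:
  fixes n :: nat and \<gamma> :: "nat \<times> nat \<Rightarrow> 'h::ab_group_add"
  assumes "n \<ge> 1"
    and "simple_cycle_free n \<gamma>"
  shows "\<exists>A. birkhoff_independent n A \<and>
             real (card A) \<ge> fact n / real (card (UNIV :: 'h set))"
proof (cases "finite (UNIV :: 'h set)")
  case True
  have "finite (sym_perms n)" "card (sym_perms n) = fact n"
    unfolding sym_perms_def
    by (simp_all add: finite_permutations card_permutations[where n = n])
  then obtain h where
    "fact n / real (card (UNIV :: 'h set)) \<le>
       real (card {\<pi> \<in> sym_perms n. perm_weight n \<gamma> \<pi> = h})"
    using exists_large_fibre[of "sym_perms n" "perm_weight n \<gamma>"] True by auto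
  then show ?thesis
    using birkhoff_independent_fibre[OF assms(2)] by blast
next
  case False
  then show ?thesis
    \<comment> \<open>The required bound is 0 here, so the empty set is large enough.\<close>
    by (intro exI[of _ "{}"]) (simp add: birkhoff_independent_def)
qed

end
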